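(* Let $d\ge 3$ be an integer. There is a one-to-one correspondence between $\mathscr{L}_d$, the set of isomorphism classes of pairs $(\mathcal{A},P)$ consisting of an arrangement $\mathcal{A}$ of $d$ lines in $\mathbb{P}^2$ and a point $P\in\mathbb{P}^2\setminus\mathcal{A}$, and the set of lines in $\mathbb{P}^{d-2}$ not contained in $\mathcal{H}_d$.
   Context: Projective spaces are over a fixed field $\mathbb{K}$, which may be arbitrary; lines, points and automorphisms are defined over $\mathbb{K}$, and containment of a line in $\mathcal{H}_d$ is meant as containment of algebraic varieties. An arrangement of $d$ lines is a set $\mathcal{A}=\{L_1,\ldots,L_d\}$ of $d$ (distinct) labeled lines in $\mathbb{P}^2$ such that $\bigcap_{i=1}^d L_i=\emptyset$. When the labelling is not relevant, $\mathcal{A}$ is also regarded as the plane curve $\bigcup_{i=1}^d L_i$, so $P\in\mathbb{P}^2\setminus\mathcal{A}$ means that $P$ lies on none of the lines $L_i$. Two pairs $(\mathcal{A},P)$ and $(\mathcal{A}',P')$ of this kind, with $\mathcal{A}'=\{L_1',\ldots,L_d'\}$, are isomorphic if there exists an automorphism $T$ of $\mathbb{P}^2$ such that $T(L_i)=L_i'$ for every $i$ and $T(P)=P'$. The set of isomorphism classes of such pairs is denoted $\mathscr{L}_d$. The hyperplane arrangement $\mathcal{H}_d\subset\mathbb{P}^{d-2}$ is $$\mathcal{H}_d=\Big\{[x_1:\ldots:x_{d-1}]\in\mathbb{P}^{d-2} : x_1x_2\cdots x_{d-1}\prod_{i<j}(x_j-x_i)=0\Big\},$$ that is, the union of the hyperplanes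 $x_i=0$ ($1\le i\le d-1$) and $x_i=x_j$ ($1\le i<j\le d-1$). Equivalently, it is the union of all hyperplanes of $\mathbb{P}^{d-2}$ spanned by $d-2$ of the $d$ points $[1:0:\ldots:0],\ [0:1:0:\ldots:0],\ \ldots,\ [0:\ldots:0:1],\ [1:\ldots:1]$. *)

theory Defs
  imports "HOL-Analysis.Analysis" "HOL-Algebra.Algebraic_Closure_Type"
begin

text \<open>Points of the projective space \<open>\<P>(K\<^sup>n)\<close> are the one-dimensional subspaces of \<open>K ^ 'n\<close>,
  so that its dimension is \<open>CARD('n) - 1\<close>. Lines are sets of points.\<close>

type_synonym ('a, 'n) proj_point = "('a ^ 'n) set"

definition proj_space :: "('a::field, 'n::finite) proj_point set" where
  "proj_space = {p. vec.subspace p \<and> vec.dim p = 1}"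

definition proj_pt :: "'a::field ^ 'n::finite \<Rightarrow> ('a, 'n) proj_point" where
  "proj_pt x = vec.span {x}"

definition proj_subspace :: "('a::field ^ 'n::finite) set \<Rightarrow> ('a, 'n) proj_point set" where
  "proj_subspace W = {p \<in> proj_space. p \<subseteq> W}"

definition proj_lines :: "('a::field, 'n::finite) proj_point set set" where
  "proj_lines = {proj_subspace W | W. vec.subspace W \<and> vec.dim W = 2}"

definition proj_auts :: "(('a::field, 'n::finite) proj_point \<Rightarrow> ('a, 'n) proj_point) set" where
  "proj_auts = {(`) ((*v) A) | A. invertible A}"


text \<open>The labelling \<open>L\<^sub>1, \<dots>, L\<^sub>d\<close> is given by the order of the list.\<close>

definition line_arrangement :: "nat \<Rightarrow> ('a::field, 3) proj_point set list \<Rightarrow> bool" where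
  "line_arrangement d As \<longleftrightarrow>
     length As = d \<and> distinct As \<and> set As \<subseteq> proj_lines \<and> \<Inter>(set As) = {}"

definition pointed_arrangements ::
  "nat \<Rightarrow> (('a::field, 3) proj_point set list \<times> ('a, 3) proj_point) set" where
  "pointed_arrangements d =
     {(As, P). line_arrangement d As \<and> P \<in> proj_space - \<Union>(set As)}"

definition pointed_arrangement_iso ::
  "nat \<Rightarrow> ((('a::field, 3) proj_point set list \<times> ('a, 3) proj_point) \<times>
           (('a, 3) proj_point set list \<times> ('a, 3) proj_point)) set" where
  "pointed_arrangement_iso d =
     {((As, P), (As', P')).
        (As, P) \<in> pointed_arrangements d \<and> (As', P') \<in> pointed_arrangements d \<and>
        (\<exists>T \<in> proj_auts. (\<forall>i<d. T ` (As ! i) = As' ! i) \<and> T P = P')}"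

definition pointed_arrangement_classes ::
  "nat \<Rightarrow> (('a::field, 3) proj_point set list \<times> ('a, 3) proj_point) set set" where
  "pointed_arrangement_classes d = pointed_arrangements d // pointed_arrangement_iso d"


definition hyp_arrangement :: "('a::field, 'n::finite) proj_point set" where
  "hyp_arrangement =
     {proj_pt x | x. x \<noteq> 0 \<and> ((\<exists>i. x $ i = 0) \<or> (\<exists>i j. i \<noteq> j \<and> x $ i = x $ j))}"

text \<open>Containment of varieties is containment of the sets of points over an algebraic closure.
  Rational points do not suffice: a line over a finite field may have all of its rational points
  on the arrangement without being contained in it. The union of a projective
  subspace, viewed as a set of points, is the underlying linear subspace.\<close>

definition geometric_points ::
  "('a::field, 'n::finite) proj_point set \<Rightarrow> ('a alg_closure, 'n) proj_point set" where
  "geometric_points l = proj_subspace (vec.span ((\<lambda>v. \<chi> i. to_ac (v $ i)) ` \<Union>l))"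

definition contained_in_hyp_arrangement :: "('a::field, 'n::finite) proj_point set \<Rightarrow> bool" where
  "contained_in_hyp_arrangement l \<longleftrightarrow> geometric_points l \<subseteq> hyp_arrangement"

end

theory Submission
  imports Defs
begin

text \<open>
  Let \<open>(\<A>, P)\<close> be a pointed arrangement and \<open>P = [p]\<close>. As \<open>P\<close> lies on no \<open>L\<^sub>i\<close>, the line \<open>L\<^sub>i\<close>
  has a unique equation \<open>a\<^sub>i\<close>, a linear form on \<open>K\<^sup>3\<close>, normalised by \<open>a\<^sub>i(p) = 1\<close>. Distinct lines have
  distinct forms, and since the lines have no common point, \<open>v \<mapsto> (a\<^sub>1(v), \<dots>, a\<^sub>d(v))\<close> embeds \<open>K\<^sup>3\<close> in
  \<open>K\<^sup>d\<close>, with \<open>p \<mapsto> (1, \<dots>, 1)\<close>. Dividing by the line of \<open>(1, \<dots>, 1)\<close>, that is, passing to the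
  differences \<open>a\<^sub>i - a\<^sub>d\<close> with \<open>i < d\<close>, gives a plane \<open>W \<subseteq> K\<^sup>d\<^sup>-\<^sup>1\<close>, hence a line in \<open>\<P>\<^sup>d\<^sup>-\<^sup>2\<close>. Distinctness
  of the forms says that no coordinate vanishes on \<open>W\<close> and that no two coordinates agree on \<open>W\<close>:
  \<open>W\<close> is contained in none of the hyperplanes that make up \<open>\<H>\<^sub>d\<close>.

  The plane \<open>W\<close> is a complete invariant. An isomorphism of pointed arrangements rescales all forms
  by one and the same constant, because it maps \<open>p\<close> to a multiple of the second base vector, and this
  does not change \<open>W\<close> (\<open>iso_imp_range_eq\<close>). Conversely the image of \<open>K\<^sup>3\<close> in \<open>K\<^sup>d\<close> is the preimage of
  \<open>W\<close>, so two pointed arrangements with the same \<open>W\<close> have the same image in \<open>K\<^sup>d\<close>; composing one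
  embedding with the inverse of the other gives the isomorphism (\<open>range_eq_imp_iso\<close>). Every admissible
  plane occurs: take two coordinate functions from a basis of \<open>W\<close> and add a third coordinate that
  all forms share (\<open>plane_is_range\<close>).

  Containment in \<open>\<H>\<^sub>d\<close> is tested over an algebraic closure. That field is infinite, so a line
  contained in the finite union \<open>\<H>\<^sub>d\<close> is contained in one of the hyperplanes, and this can be read
  off already over \<open>K\<close> (\<open>contained_in_hyp_arrangement_iff\<close>).
\<close>

(* The coefficient notation of formal power series makes every vector component ambiguous. *)
no_notation fps_nth (infixl "$" 75)

section \<open>Quotients by the fibres of a relation\<close>

text \<open>The invariant of a pointed arrangement involves choices (a base vector and equations), so it is
  given as a relation. Applied to one object related to two values, the fibre condition shows that
  the relation is single-valued; in general it makes \<open>E\<close> the kernel of the resulting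
  function, which therefore descends to a bijection.\<close>

lemma bij_betw_quotient_of_relation:
  assumes total: "\<And>x. x \<in> S \<Longrightarrow> \<exists>y\<in>Y. R x y"
    and onto: "\<And>y. y \<in> Y \<Longrightarrow> \<exists>x\<in>S. R x y"
    and fibres: "\<And>x x' y y'. \<lbrakk>x \<in> S; x' \<in> S; R x y; R x' y'\<rbrakk> \<Longrightarrow> (x, x') \<in> E \<longleftrightarrow> y = y'"
    and E: "E \<subseteq> S \<times> S"
  shows "\<exists>f. bij_betw f (S // E) Y"
proof -
  obtain g where g: "\<And>x. x \<in> S \<Longrightarrow> g x \<in> Y \<and> R x (g x)"
    using total by metis
  have E_iff: "(x, x') \<in> E \<longleftrightarrow> x \<in> S \<and> x' \<in> S \<and> g x = g x'" for x x'
    using E fibres g by blast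
  have class_eq: "E `` {x} = {x' \<in> S. g x' = g x}" if "x \<in> S" for x
    using that by (auto simp: E_iff)
  have img: "g ` (E `` {x}) = {g x}" if "x \<in> S" for x
    using that by (auto simp: class_eq)
  have "bij_betw (\<lambda>C. the_elem (g ` C)) (S // E) Y"
  proof (rule bij_betwI')
    fix C C' assume "C \<in> S // E" "C' \<in> S // E"
    then obtain x x' where "x \<in> S" "C = E `` {x}" "x' \<in> S" "C' = E `` {x'}"
      by (auto elim!: quotientE)
    then show "(the_elem (g ` C) = the_elem (g ` C')) = (C = C')"
      using img[of x] img[of x'] class_eq[of x] class_eq[of x'] by (metis the_elem_eq)
  next
    fix C assume "C \<in> S // E"
    then show "the_elem (g ` C) \<in> Y"
      using g img by (metis quotientE the_elem_eq)
  next
    fix y assume "y \<in> Y"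
    then obtain x where x: "x \<in> S" "R x y" using onto by blast
    have "g x = y" using fibres[OF x(1) x(1), of "g x" y] fibres[OF x(1) x(1) x(2) x(2)] g x by blast
    then show "\<exists>C\<in>S // E. y = the_elem (g ` C)"
      using x img by (metis quotientI the_elem_eq)
  qed
  then show ?thesis by blast
qed

section \<open>Linear forms and their kernels\<close>

lemma scalar_product_simps:
  fixes a b v w :: "'a::field^'n::finite"
  shows "scalar_product a (v + w) = scalar_product a v + scalar_product a w"
    and "scalar_product a (v - w) = scalar_product a v - scalar_product a w"
    and "scalar_product a (c *s v) = c * scalar_product a v"
    and "scalar_product (a - b) v = scalar_product a v - scalar_product b v"
    and "scalar_product a 0 = 0"
  by (simp_all add: scalar_product_def algebra_simps sum.distrib sum_subtractf sum_distrib_left)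

lemma matrix_vector_mult_row:
  fixes M :: "'a::field^'k::finite^'n::finite"
  shows "(M *v v) $ n = scalar_product (M $ n) v"
  by (simp add: matrix_vector_mult_def scalar_product_def)

lemma scalar_product_axis:
  fixes a :: "'a::field^'n::finite"
  shows "scalar_product a (axis k 1) = a $ k"
  by (simp add: scalar_product_def axis_def if_distrib cong: if_cong)

lemma scalar_product_eqI:
  fixes a b :: "'a::field^'n::finite"
  assumes "\<And>v. scalar_product a v = scalar_product b v"
  shows "a = b"
  using assms by (metis scalar_product_axis vec_eq_iff)

definition hyperplane :: "'a::field^'n::finite \<Rightarrow> ('a^'n) set" where
  "hyperplane a = {v. scalar_product a v = 0}"

lemma mem_hyperplane [simp]: "v \<in> hyperplane a \<longleftrightarrow> scalar_product a v = 0"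
  by (simp add: hyperplane_def)

lemma subspace_hyperplane [simp]: "vec.subspace (hyperplane a)"
  by (rule vec.subspaceI) (simp_all add: scalar_product_simps)

text \<open>The whole space is the sum of the kernel and the line through \<open>p\<close>, by
  \<open>v = (v - a(v) p) + a(v) p\<close>.\<close>

lemma dim_hyperplane:
  fixes a p :: "'a::field^'n::finite"
  assumes "scalar_product a p = 1"
  shows "Suc (vec.dim (hyperplane a)) = CARD('n)"
proof -
  have "v \<in> vec.span (insert p (hyperplane a))" for v
    unfolding vec.span_insert
    using assms by (auto intro!: exI[of _ "scalar_product a v"] vec.span_base simp: scalar_product_simps)
  then have "vec.dim (insert p (hyperplane a)) = CARD('n)"
    by (metis UNIV_eq_I vec.dim_span vec.dim_UNIV vec.dimension_def card_cart_basis)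
  moreover have "p \<notin> vec.span (hyperplane a)"
    using assms by (simp add: vec.span_eq_iff[THEN iffD2])
  ultimately show ?thesis by (simp add: vec.dim_insert)
qed

text \<open>A basis of \<open>W\<close> together with \<open>p\<close> is independent, so some linear form vanishes on \<open>W\<close> and has the
  value 1 at \<open>p\<close>; its kernel contains \<open>W\<close> and has the same dimension.\<close>

lemma normalized_equation_exists:
  fixes p :: "'a::field^'n::finite"
  assumes W: "vec.subspace W" "Suc (vec.dim W) = CARD('n)" and p: "p \<notin> W"
  obtains a where "scalar_product a p = 1" "W = hyperplane a"
proof -
  obtain B where B: "B \<subseteq> W" "vec.independent B" "W \<subseteq> vec.span B"
    using vec.basis_exists[of W] by metis
  have spB: "vec.span B = W" using B W by (simp add: vec.span_subspace)
  have ind: "vec.independent (insert p B)"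
    using B p spB by (simp add: vec.independent_insertI)
  \<comment> \<open>The form is extended as a map to \<open>K\<^sup>1\<close>, so that it has a matrix, whose row is \<open>a\<close>.\<close>
  obtain f :: "'a^'n \<Rightarrow> 'a^1" where f: "Vector_Spaces.linear (*s) (*s) f"
    "\<And>x. x \<in> insert p B \<Longrightarrow> f x = (if x = p then 1 else 0)"
    using vec.linear_independent_extend[OF ind, of "\<lambda>x. if x = p then 1 else 0"] by metis
  define a where "a = matrix f $ 1"
  have fa: "f x $ 1 = scalar_product a x" for x
    using matrix_works[OF f(1), of x] matrix_vector_mult_row[of "matrix f" x 1] by (simp add: a_def)
  have p1: "scalar_product a p = 1"
    using f(2)[of p] fa[of p] by simp
  have "B \<subseteq> hyperplane a"
  proof
    fix x assume x: "x \<in> B"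
    then have "f x = 0" using f(2)[of x] B p by auto
    then show "x \<in> hyperplane a" using fa[of x] by simp
  qed
  then have sub: "W \<subseteq> hyperplane a"
    using spB vec.span_minimal subspace_hyperplane by metis
  have "W = hyperplane a"
    using dim_hyperplane[OF p1] W(2)
    by (intro vec.subspace_dim_equal[OF W(1) _ sub]) simp_all
  then show ?thesis using that p1 by blast
qed

section \<open>Points, subspaces and automorphisms of projective space\<close>

lemma mem_proj_space: "P \<in> proj_space \<longleftrightarrow> (\<exists>x. x \<noteq> 0 \<and> P = proj_pt x)"
proof
  assume P: "P \<in> proj_space"
  then obtain B where B: "B \<subseteq> P" "vec.independent B" "P \<subseteq> vec.span B" "card B = 1"
    using vec.basis_exists[of P] by (auto simp: proj_space_def)
  then obtain x where x: "B = {x}" by (metis card_1_singletonE)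
  then have "x \<noteq> 0" "P = vec.span {x}"
    using B P by (auto simp: proj_space_def vec.span_subspace)
  then show "\<exists>x. x \<noteq> 0 \<and> P = proj_pt x" by (auto simp: proj_pt_def)
next
  assume "\<exists>x. x \<noteq> 0 \<and> P = proj_pt x"
  then obtain x where "x \<noteq> 0" "P = vec.span {x}" by (auto simp: proj_pt_def)
  then show "P \<in> proj_space"
    using vec.dim_span_eq_card_independent[of "{x}"] by (simp add: proj_space_def)
qed

lemma proj_pt_altdef: "proj_pt x = range (\<lambda>c. c *s x)"
  by (simp add: proj_pt_def vec.span_singleton)

lemma proj_pt_mem_proj_subspace:
  assumes "vec.subspace W" "x \<noteq> 0"
  shows "proj_pt x \<in> proj_subspace W \<longleftrightarrow> x \<in> W"
  using assms vec.span_minimal[of "{x}" W] vec.span_base[of x "{x}"] mem_proj_space[of "proj_pt x"]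
  by (auto simp: proj_subspace_def proj_pt_def)

text \<open>This recovers a linear subspace from its projective points. For \<open>W = {0}\<close> there are no points and
  the union is empty, whence the condition on the dimension.\<close>

lemma Union_proj_subspace:
  fixes W :: "('a::field^'n::finite) set"
  assumes "vec.subspace W" "vec.dim W \<noteq> 0"
  shows "\<Union>(proj_subspace W) = W"
proof
  show "\<Union>(proj_subspace W) \<subseteq> W" by (auto simp: proj_subspace_def)
  have "v \<in> proj_pt v" for v :: "'a^'n"
    by (simp add: proj_pt_def vec.span_base)
  then have nz: "v \<in> \<Union>(proj_subspace W)" if "v \<in> W" "v \<noteq> 0" for v
    using that assms proj_pt_mem_proj_subspace[of W v] by blast
  obtain u where u: "u \<in> W" "u \<noteq> 0"
    using assms vec.dim_eq_0 by (metis singletonI subset_iff)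
  have "proj_pt u \<in> proj_subspace W"
    using u assms by (simp add: proj_pt_mem_proj_subspace)
  moreover have "0 \<in> proj_pt u"
    by (simp add: proj_pt_def vec.span_zero)
  ultimately have "0 \<in> \<Union>(proj_subspace W)" by blast
  with nz show "W \<subseteq> \<Union>(proj_subspace W)" by blast
qed

lemma proj_aut_proj_pt:
  "((*v) A) ` proj_pt x = proj_pt (A *v x)"
  by (simp add: proj_pt_altdef image_image vec.scale)

lemma proj_pt_eq_iff:
  fixes x y :: "'a::field^'n::finite"
  assumes "x \<noteq> 0" 
  shows "proj_pt x = proj_pt y \<longleftrightarrow> (\<exists>c. c \<noteq> 0 \<and> x = c *s y)"
proof
  assume "proj_pt x = proj_pt y"
  then have "x \<in> proj_pt y" using vec.span_base[of x "{x}"] by (simp add: proj_pt_def)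
  then show "\<exists>c. c \<noteq> 0 \<and> x = c *s y" using assms by (auto simp: proj_pt_altdef)
next
  assume "\<exists>c. c \<noteq> 0 \<and> x = c *s y"
  then obtain c where c: "c \<noteq> 0" "x = c *s y" by blast
  have "k *s y \<in> proj_pt x" for k
    using c by (auto simp: proj_pt_altdef intro!: image_eqI[of _ _ "k / c"])
  moreover have "k *s x \<in> proj_pt y" for k using c by (auto simp: proj_pt_altdef)
  ultimately show "proj_pt x = proj_pt y" by (auto simp: proj_pt_altdef)
qed

lemma proj_aut_proj_subspace:
  fixes A :: "'a::field^'n::finite^'n"
  assumes "invertible A" "vec.subspace W"
  shows "((`) ((*v) A)) ` proj_subspace W = proj_subspace ((*v) A ` W)"
proof -
  have inj: "A *v x = 0 \<longleftrightarrow> x = 0" for x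
    using assms(1) by (metis invertible_left_inverse matrix_left_invertible_ker vec.zero)
  have sub: "vec.subspace ((*v) A ` W)"
    using assms(2) by (rule vec.subspace_image)
  show ?thesis
  proof (intro Set.set_eqI iffI)
    fix Q assume "Q \<in> (`) ((*v) A) ` proj_subspace W"
    then obtain x where x: "x \<noteq> 0" "proj_pt x \<in> proj_subspace W" "Q = (*v) A ` proj_pt x"
      by (auto simp: proj_subspace_def mem_proj_space)
    then show "Q \<in> proj_subspace ((*v) A ` W)"
      using sub assms inj by (simp add: proj_aut_proj_pt proj_pt_mem_proj_subspace)
  next
    fix Q assume Q: "Q \<in> proj_subspace ((*v) A ` W)"
    then obtain y where y: "y \<noteq> 0" "Q = proj_pt y"
      by (auto simp: proj_subspace_def mem_proj_space)
    then obtain x where "x \<in> W" "y = A *v x"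
      using Q sub by (auto simp: proj_pt_mem_proj_subspace)
    then show "Q \<in> (`) ((*v) A) ` proj_subspace W"
      using y assms inj by (auto simp: proj_aut_proj_pt[symmetric] proj_pt_mem_proj_subspace intro!: imageI)
  qed
qed

section \<open>Containment in the hyperplane arrangement\<close>

lemma basis_of_dim_2:
  fixes W :: "('a::field^'n::finite) set"
  assumes "vec.subspace W" "vec.dim W = 2"
  obtains u v where "W = {s *s u + t *s v | s t. True}"
    and "\<And>s t. s *s u + t *s v = 0 \<Longrightarrow> s = 0 \<and> t = 0"
proof -
  obtain B where B: "B \<subseteq> W" "vec.independent B" "W \<subseteq> vec.span B" "card B = 2"
    using vec.basis_exists[of W] assms by metis
  then obtain u v where uv: "B = {u, v}" "u \<noteq> v" by (metis card_2_iff)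
  have W: "W = vec.span {u, v}" using B assms uv by (metis vec.span_subspace)
  have "W = {s *s u + t *s v | s t. True}"
  proof (intro Set.set_eqI iffI)
    fix x assume "x \<in> W"
    then obtain s t where "x - s *s u = t *s v"
      unfolding W vec.span_insert[of u] vec.span_singleton by auto
    then have "x = s *s u + t *s v" by (simp add: algebra_simps)
    then show "x \<in> {s *s u + t *s v | s t. True}" by blast
  next
    fix x assume "x \<in> {s *s u + t *s v | s t. True}"
    then show "x \<in> W" unfolding W
      using vec.span_add vec.span_scale vec.span_base[of _ "{u, v}"] by blast
  qed
  moreover have "s = 0 \<and> t = 0" if "s *s u + t *s v = 0" for s t
  proof -
    have "(\<Sum>x\<in>{u, v}. (if x = u then s else t) *s x) = 0" using uv that by simp
    then have "\<forall>x\<in>{u, v}. (if x = u then s else t) = 0"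
      using B(2) uv vec.independentD[of "{u,v}" "{u,v}" "\<lambda>x. if x = u then s else t"] by auto
    then show ?thesis using uv by auto
  qed
  ultimately show ?thesis using that by blast
qed

text \<open>Over a finite field the polynomial \<open>1 + \<Prod>\<^sub>a (X - a)\<close> would have no root.\<close>

lemma infinite_alg_closed_field: "infinite (UNIV :: 'a::alg_closed_field set)"
proof
  assume fin: "finite (UNIV :: 'a set)"
  define q :: "'a poly" where "q = (\<Prod>a\<in>UNIV. [:- a, 1:])"
  have dq: "Polynomial.degree q > 0"
    unfolding q_def using fin by (subst Polynomial.degree_prod_eq_sum_degree) (auto simp: card_gt_0_iff)
  then have "Polynomial.degree (q + 1) = Polynomial.degree q" by (intro degree_add_eq_left) simp
  then obtain z where "poly (q + 1) z = 0"
    using dq alg_closed_imp_poly_has_root[of "q + 1"] by auto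
  moreover have "poly q z = 0"
    unfolding q_def poly_prod using fin by (intro prod_zero) auto
  ultimately show False by simp
qed

text \<open>The hyperplanes \<open>x\<^sub>i = 0\<close> and \<open>x\<^sub>i = x\<^sub>j\<close> are the irreducible components of \<open>\<H>\<^sub>d\<close>, and an irreducible
  variety such as a line is contained in \<open>\<H>\<^sub>d\<close> only if it is contained in one of them.\<close>

definition in_one_hyperplane :: "('a::field^'n::finite) set \<Rightarrow> bool" where
  "in_one_hyperplane W \<longleftrightarrow>
     (\<exists>i. \<forall>w\<in>W. w $ i = 0) \<or> (\<exists>i j. i \<noteq> j \<and> (\<forall>w\<in>W. w $ i = w $ j))"

text \<open>If no hyperplane of \<open>\<H>\<^sub>d\<close> contains \<open>W\<close>, then on the line \<open>u + t v\<close> through a basis \<open>u\<close>, \<open>v\<close> of \<open>W\<close>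
  each of the finitely many hyperplanes excludes at most one parameter \<open>t\<close>, and an infinite field
  has a parameter left. Conversely, a linear equation of \<open>W\<close> over \<open>K\<close> also holds on the span of \<open>W\<close>
  over the algebraic closure.\<close>

lemma contained_in_hyp_arrangement_iff:
  fixes W :: "('a::field^'n::finite) set"
  assumes W: "vec.subspace W" "vec.dim W = 2"
  shows "contained_in_hyp_arrangement (proj_subspace W) \<longleftrightarrow> in_one_hyperplane W"
proof -
  define ext :: "'a^'n \<Rightarrow> ('a alg_closure)^'n" where "ext v = (\<chi> i. to_ac (v $ i))" for v
  have ext_nth [simp]: "ext v $ i = to_ac (v $ i)" for v i by (simp add: ext_def)
  have geo: "geometric_points (proj_subspace W) = proj_subspace (vec.span (ext ` W))"
    using W by (simp add: geometric_points_def Union_proj_subspace ext_def[abs_def])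
  show ?thesis
  proof
    assume "in_one_hyperplane W"
    then obtain a :: "('a alg_closure)^'n" where a: "ext ` W \<subseteq> hyperplane a"
      "\<And>x. x \<noteq> 0 \<Longrightarrow> x \<in> hyperplane a \<Longrightarrow> (\<exists>i. x $ i = 0) \<or> (\<exists>i j. i \<noteq> j \<and> x $ i = x $ j)"
    proof -
      have sym: "scalar_product (axis i 1) x = x $ i" for i and x :: "('a alg_closure)^'n"
        using scalar_product_axis[of x i] by (simp add: scalar_product_def mult.commute)
      from \<open>in_one_hyperplane W\<close> consider i where "\<forall>w\<in>W. w $ i = 0"
        | i j where "i \<noteq> j" "\<forall>w\<in>W. w $ i = w $ j"
        unfolding in_one_hyperplane_def by blast
      then show ?thesis
      proof cases
        case 1
        then show ?thesis by (intro that[of "axis i 1"]) (auto simp: sym)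
      next
        case 2
        then show ?thesis
          by (intro that[of "axis i 1 - axis j 1"]) (auto simp: sym scalar_product_simps)
      qed
    qed
    have sp: "vec.span (ext ` W) \<subseteq> hyperplane a"
      using a(1) by (intro vec.span_minimal) auto
    show "contained_in_hyp_arrangement (proj_subspace W)"
      unfolding contained_in_hyp_arrangement_def geo
    proof
      fix Q assume Q: "Q \<in> proj_subspace (vec.span (ext ` W))"
      then obtain x where x: "x \<noteq> 0" "Q = proj_pt x"
        by (auto simp: proj_subspace_def mem_proj_space)
      then have "x \<in> hyperplane a"
        using Q sp by (auto simp: proj_pt_mem_proj_subspace)
      then show "Q \<in> hyp_arrangement"
        using x a(2)[of x] unfolding hyp_arrangement_def by blast
    qed
  next
    assume con: "contained_in_hyp_arrangement (proj_subspace W)"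
    show "in_one_hyperplane W"
    proof (rule ccontr)
      assume no: "\<not> in_one_hyperplane W"
      obtain u v where uv: "W = {s *s u + t *s v | s t. True}"
        using basis_of_dim_2[OF W] by metis
      have "u = 1 *s u + 0 *s v" "v = 0 *s u + 1 *s v" by simp_all
      then have uvW: "u \<in> W" "v \<in> W" unfolding uv by blast+
      have i0: "\<not> (u $ i = 0 \<and> v $ i = 0)" for i
      proof
        assume "u $ i = 0 \<and> v $ i = 0"
        then have "\<forall>w\<in>W. w $ i = 0" unfolding uv by auto
        then show False using no unfolding in_one_hyperplane_def by blast
      qed
      have ij: "\<not> (u $ i = u $ j \<and> v $ i = v $ j)" if "i \<noteq> j" for i j
      proof
        assume "u $ i = u $ j \<and> v $ i = v $ j"
        then have "\<forall>w\<in>W. w $ i = w $ j" unfolding uv by auto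
        then show False using no that unfolding in_one_hyperplane_def by blast
      qed
      have root: "finite {t. to_ac b + t * to_ac c = 0}" if "\<not> (b = 0 \<and> c = 0)" for b c :: 'a
      proof (cases "c = 0")
        case False
        have "t = - to_ac b / to_ac c" if "to_ac b + t * to_ac c = 0" for t
        proof -
          have "t * to_ac c = - to_ac b" using that by (simp only: add_eq_0_iff)
          with False show ?thesis by (simp only: nonzero_eq_divide_eq to_ac_eq_0_iff simp_thms)
        qed
        then have "{t. to_ac b + t * to_ac c = 0} \<subseteq> {- to_ac b / to_ac c}" by blast
        then show ?thesis using finite_subset by blast
      qed (use that in simp)
      define bad where "bad =
        (\<Union>i. {t. to_ac (u $ i) + t * to_ac (v $ i) = 0}) \<union>
        (\<Union>(i, j)\<in>{(i, j). i \<noteq> j}. {t. to_ac (u $ i - u $ j) + t * to_ac (v $ i - v $ j) = 0})"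
      have "finite {t. to_ac (u $ i) + t * to_ac (v $ i) = 0}" for i
        using root i0 by blast
      moreover have "finite {t. to_ac (u $ i - u $ j) + t * to_ac (v $ i - v $ j) = 0}"
        if "i \<noteq> j" for i j
        using ij[OF that] by (intro root) simp
      ultimately have "finite bad"
        unfolding bad_def by (intro finite_UnI finite_UN_I) (auto simp del: to_ac_diff)
      then obtain t where t: "t \<notin> bad"
        using infinite_alg_closed_field ex_new_if_finite by blast
      define x where "x = ext u + t *s ext v"
      have x0: "x $ i \<noteq> 0" for i
        using t by (auto simp: bad_def x_def)
      have xij: "x $ i \<noteq> x $ j" if "i \<noteq> j" for i j
      proof
        assume "x $ i = x $ j"
        then have "to_ac (u $ i - u $ j) + t * to_ac (v $ i - v $ j) = 0"
          by (simp add: x_def algebra_simps)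
        then show False using t that by (auto simp: bad_def)
      qed
      have xn: "x \<noteq> 0" using x0 by auto
      have "x \<in> vec.span (ext ` W)"
        unfolding x_def using uvW by (intro vec.span_add vec.span_scale vec.span_base) auto
      then have "proj_pt x \<in> hyp_arrangement"
        using con xn unfolding contained_in_hyp_arrangement_def geo
        by (auto simp: proj_pt_mem_proj_subspace)
      then obtain y where y: "proj_pt x = proj_pt y"
        "(\<exists>i. y $ i = 0) \<or> (\<exists>i j. i \<noteq> j \<and> y $ i = y $ j)"
        by (auto simp: hyp_arrangement_def)
      obtain c where "x = c *s y" using y(1) proj_pt_eq_iff[OF xn] by blast
      then show False using y(2) x0 xij by force
    qed
  qed
qed

section \<open>Pointed arrangements and normalised forms\<close>

definition normalized_forms :: "nat \<Rightarrow> (nat \<Rightarrow> 'a::field^3) \<Rightarrow> 'a^3 \<Rightarrow> bool" where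
  "normalized_forms d a p \<longleftrightarrow>
     (\<forall>i<d. scalar_product (a i) p = 1) \<and> inj_on a {..<d} \<and>
     (\<forall>v. (\<forall>i<d. scalar_product (a i) v = 0) \<longrightarrow> v = 0)"

definition arrangement_of ::
  "nat \<Rightarrow> (nat \<Rightarrow> 'a::field^3) \<Rightarrow> 'a^3 \<Rightarrow> ('a, 3) proj_point set list \<times> ('a, 3) proj_point"
  where "arrangement_of d a p = (map (\<lambda>i. proj_subspace (hyperplane (a i))) [0..<d], proj_pt p)"

definition difference_matrix ::
  "('n::finite \<Rightarrow> nat) \<Rightarrow> nat \<Rightarrow> (nat \<Rightarrow> 'a::field^3) \<Rightarrow> 'a^3^'n" where
  "difference_matrix ix m a = (\<chi> n. a (ix n) - a m)"

lemma normalized_forms_nonzero: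
  assumes "normalized_forms d a p" "0 < d"
  shows "p \<noteq> 0"
  using assms by (force simp: normalized_forms_def scalar_product_simps)

lemma dim_hyperplane_3:
  fixes a p :: "'a::field^3"
  assumes "scalar_product a p = 1"
  shows "vec.dim (hyperplane a) = 2"
  using dim_hyperplane[OF assms] by simp

text \<open>Two forms with the same kernel agree, because both have the value 1 at \<open>p\<close>; hence distinct forms
  define distinct lines.\<close>

lemma arrangement_of_mem:
  assumes nf: "normalized_forms d a p" and d: "0 < d"
  shows "arrangement_of d a p \<in> pointed_arrangements d"
proof -
  let ?L = "\<lambda>i. proj_subspace (hyperplane (a i))"
  have ap: "scalar_product (a i) p = 1" if "i < d" for i
    using nf that by (simp add: normalized_forms_def)
  have lines: "?L i \<in> proj_lines" if "i < d" for i
    using dim_hyperplane_3[OF ap[OF that]] unfolding proj_lines_def by auto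
  have hyp: "\<Union>(?L i) = hyperplane (a i)" if "i < d" for i
    using dim_hyperplane_3[OF ap[OF that]] by (simp add: Union_proj_subspace)
  have "inj_on ?L {..<d}"
  proof (rule inj_onI)
    fix i j assume i: "i \<in> {..<d}" and j: "j \<in> {..<d}" and "?L i = ?L j"
    then have eq: "hyperplane (a i) = hyperplane (a j)" using hyp by (metis lessThan_iff)
    have "scalar_product (a i) v = scalar_product (a j) v" for v
    proof -
      have "v - scalar_product (a i) v *s p \<in> hyperplane (a i)"
        using ap i by (simp add: scalar_product_simps)
      then have "v - scalar_product (a i) v *s p \<in> hyperplane (a j)" using eq by simp
      then show ?thesis using ap j by (simp add: scalar_product_simps)
    qed
    then have "a i = a j" by (rule scalar_product_eqI)
    then show "i = j" using nf i j by (auto simp: normalized_forms_def inj_on_def)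
  qed
  then have dist: "distinct (map ?L [0..<d])"
    by (simp add: distinct_map atLeast0LessThan)
  have empty: "\<Inter>(set (map ?L [0..<d])) = {}"
  proof (rule ccontr)
    assume "\<not> ?thesis"
    then obtain Q where "Q \<in> \<Inter>(set (map ?L [0..<d]))" by blast
    then have Q: "Q \<in> ?L i" if "i < d" for i using that by simp
    then have "Q \<in> proj_space" using d by (auto simp: proj_subspace_def)
    then obtain x where x: "x \<noteq> 0" "Q = proj_pt x" by (auto simp: mem_proj_space)
    then have "\<forall>i<d. scalar_product (a i) x = 0"
      using Q by (simp add: proj_pt_mem_proj_subspace)
    then show False using nf x by (simp add: normalized_forms_def)
  qed
  have p: "p \<noteq> 0" using normalized_forms_nonzero[OF assms] .
  have "proj_pt p \<notin> ?L i" if "i < d" for i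
    using p ap[OF that] by (simp add: proj_pt_mem_proj_subspace)
  moreover have "proj_pt p \<in> proj_space" using p mem_proj_space by blast
  ultimately show ?thesis
    using lines dist empty
    by (auto simp: arrangement_of_def pointed_arrangements_def line_arrangement_def)
qed

text \<open>The point lies on no line, so each line has an equation with the value 1 at a vector
  that represents the point.\<close>

lemma pointed_arrangement_normalized:
  fixes x :: "('a::field, 3) proj_point set list \<times> ('a, 3) proj_point"
  assumes "x \<in> pointed_arrangements d"
  obtains a p where "normalized_forms d a p" "x = arrangement_of d a p"
proof -
  obtain As P where x: "x = (As, P)" by fastforce
  have len: "length As = d" and dist: "distinct As" and lines: "set As \<subseteq> proj_lines"
    and empty: "\<Inter>(set As) = {}" and P: "P \<in> proj_space" "P \<notin> \<Union>(set As)"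
    using assms by (auto simp: x pointed_arrangements_def line_arrangement_def)
  obtain p where p: "p \<noteq> 0" "P = proj_pt p" using P by (auto simp: mem_proj_space)
  have "\<exists>b. scalar_product b p = 1 \<and> As ! i = proj_subspace (hyperplane b)" if i: "i < d" for i
  proof -
    have mem: "As ! i \<in> set As" using i len by simp
    then obtain W where W: "As ! i = proj_subspace W" "vec.subspace W" "vec.dim W = 2"
      using lines by (auto simp: proj_lines_def)
    have "p \<notin> W" using P p W mem proj_pt_mem_proj_subspace[of W p] by blast
    then show ?thesis using normalized_equation_exists[of W p] W by auto
  qed
  then obtain a where a: "\<And>i. i < d \<Longrightarrow> scalar_product (a i) p = 1"
    "\<And>i. i < d \<Longrightarrow> As ! i = proj_subspace (hyperplane (a i))"
    by metis
  have "inj_on a {..<d}"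
    using dist a(2) len by (auto intro!: inj_onI simp: nth_eq_iff_index_eq[symmetric])
  moreover have "v = 0" if v: "\<forall>i<d. scalar_product (a i) v = 0" for v
  proof (rule ccontr)
    assume "v \<noteq> 0"
    then have "proj_pt v \<in> As ! i" if "i < d" for i
      using that v a(2) by (simp add: proj_pt_mem_proj_subspace)
    then have "proj_pt v \<in> \<Inter>(set As)" using len by (auto simp: in_set_conv_nth)
    then show False using empty by simp
  qed
  ultimately have "normalized_forms d a p" using a by (simp add: normalized_forms_def)
  moreover have "x = arrangement_of d a p"
    using a len by (auto simp: x arrangement_of_def p intro: nth_equalityI)
  ultimately show ?thesis using that by blast
qed

section \<open>The plane of differences\<close>

text \<open>The coordinates of \<open>K\<^sup>d\<^sup>-\<^sup>1\<close> are labelled by a type, the lines by numbers. The map \<open>ix\<close> identifies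
  the coordinates with the lines other than the last one, and \<open>m = d - 1\<close> is the number of the last line,
  since counting starts from 0.\<close>

locale indexing =
  fixes ix :: "'n::finite \<Rightarrow> nat" and m :: nat
  assumes ix: "bij_betw ix UNIV {..<m}"
begin

lemma ix_less: "ix n < m"
  using ix by (auto simp: bij_betw_def)

lemma ix_cases:
  assumes "i < Suc m"
  obtains "i = m" | n where "i = ix n"
  using assms ix by (metis bij_betw_imp_surj_on imageE lessThan_iff less_Suc_eq)

lemma difference_matrix_nth:
  "(difference_matrix ix m a *v v) $ n = scalar_product (a (ix n)) v - scalar_product (a m) v"
  by (simp add: matrix_vector_mult_row difference_matrix_def scalar_product_simps)

lemma difference_matrix_point:
  assumes "normalized_forms (Suc m) a p"
  shows "difference_matrix ix m a *v p = 0"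
  using assms less_SucI[OF ix_less]
  by (simp add: vec_eq_iff difference_matrix_nth normalized_forms_def)

text \<open>The differences together with the last form determine all forms, and these separate vectors.
  This injectivity makes the isomorphism below well defined and linear.\<close>

lemma normalized_forms_eqI:
  assumes "normalized_forms (Suc m) a p"
    and "difference_matrix ix m a *v v = difference_matrix ix m a *v w"
    and "scalar_product (a m) v = scalar_product (a m) w"
  shows "v = w"
proof -
  have "scalar_product (a i) (v - w) = 0" if "i < Suc m" for i
    using that
  proof (cases rule: ix_cases)
    case (2 n)
    have "(difference_matrix ix m a *v v) $ n = (difference_matrix ix m a *v w) $ n"
      using assms(2) by simp
    then show ?thesis using 2 assms(3) by (simp add: difference_matrix_nth scalar_product_simps)
  qed (use assms(3) in \<open>simp add: scalar_product_simps\<close>)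
  then have "v - w = 0" using assms(1) unfolding normalized_forms_def by blast
  then show ?thesis by simp
qed

text \<open>The kernel of the matrix is spanned by \<open>p\<close>, and the kernel of the last form is a complement of it,
  which the matrix therefore maps isomorphically onto its range.\<close>

lemma dim_range_difference_matrix:
  assumes nf: "normalized_forms (Suc m) a p"
  shows "vec.dim (range ((*v) (difference_matrix ix m a))) = 2"
proof -
  let ?M = "difference_matrix ix m a"
  have am: "scalar_product (a m) p = 1" using nf by (simp add: normalized_forms_def)
  have "?M *v v \<in> (*v) ?M ` hyperplane (a m)" for v
  proof (rule image_eqI)
    show "?M *v v = ?M *v (v - scalar_product (a m) v *s p)"
      using difference_matrix_point[OF nf] by (simp add: vec.diff vec.scale)
    show "v - scalar_product (a m) v *s p \<in> hyperplane (a m)"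
      using am by (simp add: scalar_product_simps)
  qed
  then have "range ((*v) ?M) = (*v) ?M ` hyperplane (a m)" by auto
  moreover have "inj_on ((*v) ?M) (hyperplane (a m))"
    using normalized_forms_eqI[OF nf] by (intro inj_onI) simp
  then have "vec.dim ((*v) ?M ` hyperplane (a m)) = vec.dim (hyperplane (a m))"
    by (intro vec.dim_image_eq) (simp_all add: vec.span_eq_iff[THEN iffD2])
  ultimately show ?thesis using dim_hyperplane_3[OF am] by simp
qed

lemma subspace_range_matrix: "vec.subspace (range ((*v) M))"
  by (rule vec.subspace_image) simp

text \<open>A coordinate that vanishes on the range means that a form equals the last one, and
  two coordinates that agree mean that two other forms are equal.\<close>

lemma range_difference_matrix_not_in_one_hyperplane:
  assumes nf: "normalized_forms (Suc m) a p"
  shows "\<not> in_one_hyperplane (range ((*v) (difference_matrix ix m a)))"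
proof
  assume "in_one_hyperplane (range ((*v) (difference_matrix ix m a)))"
  then consider i where "\<forall>v. (difference_matrix ix m a *v v) $ i = 0"
    | i j where "i \<noteq> j"
      "\<forall>v. (difference_matrix ix m a *v v) $ i = (difference_matrix ix m a *v v) $ j"
    by (auto simp: in_one_hyperplane_def)
  then obtain k l where kl: "k < Suc m" "l < Suc m" "k \<noteq> l"
    "\<And>v. scalar_product (a k) v = scalar_product (a l) v"
  proof cases
    case 1
    then show ?thesis
      using ix_less[of i] by (intro that[of "ix i" m]) (auto simp: difference_matrix_nth)
  next
    case 2
    then have "ix i \<noteq> ix j" using ix by (auto simp: bij_betw_def inj_on_def)
    then show ?thesis
      using 2 ix_less[of i] ix_less[of j]
      by (intro that[of "ix i" "ix j"]) (auto simp: difference_matrix_nth)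
  qed
  then have "a k = a l" by (intro scalar_product_eqI)
  then show False using nf kl by (auto simp: normalized_forms_def inj_on_def)
qed

text \<open>An isomorphism \<open>A\<close> maps the kernel of \<open>a i\<close> into that of \<open>b i\<close>, so \<open>b i \<circ> A\<close> is a multiple of \<open>a i\<close>;
  evaluation at \<open>p\<close>, where \<open>A p = c q\<close>, shows that the factor is \<open>c\<close> for every \<open>i\<close>.\<close>

lemma iso_imp_range_eq:
  assumes nfa: "normalized_forms (Suc m) a p" and nfb: "normalized_forms (Suc m) b q"
    and iso: "(arrangement_of (Suc m) a p, arrangement_of (Suc m) b q) \<in> pointed_arrangement_iso (Suc m)"
  shows "range ((*v) (difference_matrix ix m a)) = range ((*v) (difference_matrix ix m b))"
proof -
  let ?Ma = "difference_matrix ix m a" and ?Mb = "difference_matrix ix m b"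
  obtain A where A: "invertible A"
    and L: "\<And>i. i < Suc m \<Longrightarrow>
      (`) ((*v) A) ` proj_subspace (hyperplane (a i)) = proj_subspace (hyperplane (b i))"
    and P: "(*v) A ` proj_pt p = proj_pt q"
    using iso by (auto simp: pointed_arrangement_iso_def arrangement_of_def proj_auts_def simp del: upt_Suc)
  have inj: "A *v x \<noteq> 0" if "x \<noteq> 0" for x
    using A that by (metis invertible_left_inverse matrix_left_invertible_ker)
  have surj: "\<exists>v. A *v v = y" for y
    using A by (metis invertible_right_inverse matrix_right_invertible_surjective surjD)
  have ap: "scalar_product (a i) p = 1" and bq: "scalar_product (b i) q = 1" if "i < Suc m" for i
    using nfa nfb that by (simp_all add: normalized_forms_def)
  have "A *v p \<noteq> 0" using inj normalized_forms_nonzero[OF nfa] by simp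
  then obtain c where c: "c \<noteq> 0" "A *v p = c *s q"
    using P proj_pt_eq_iff[of "A *v p" q] by (auto simp: proj_aut_proj_pt)
  have hyp: "A *v v \<in> hyperplane (b i)" if i: "i < Suc m" and v: "v \<in> hyperplane (a i)" for i v
  proof (cases "v = 0")
    case False
    then have "proj_pt v \<in> proj_subspace (hyperplane (a i))"
      using v by (simp add: proj_pt_mem_proj_subspace)
    then have "proj_pt (A *v v) \<in> proj_subspace (hyperplane (b i))"
      using L[OF i] proj_aut_proj_pt[of A v] by blast
    then show ?thesis using False inj by (simp add: proj_pt_mem_proj_subspace)
  qed (simp add: scalar_product_simps)
  have scale: "scalar_product (b i) (A *v v) = c * scalar_product (a i) v" if i: "i < Suc m" for i v
  proof -
    have "v - scalar_product (a i) v *s p \<in> hyperplane (a i)"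
      using ap[OF i] by (simp add: scalar_product_simps)
    from hyp[OF i this] show ?thesis
      using c bq[OF i] by (simp add: vec.diff vec.scale scalar_product_simps)
  qed
  have M: "?Mb *v (A *v v) = c *s (?Ma *v v)" for v
    using scale ix_less less_SucI[OF ix_less]
    by (simp add: vec_eq_iff difference_matrix_nth right_diff_distrib)
  show ?thesis
  proof (intro equalityI subsetI)
    fix w assume "w \<in> range ((*v) ?Ma)"
    then obtain v where "w = ?Ma *v v" by blast
    then have "w = ?Mb *v (A *v ((1 / c) *s v))"
      using c by (simp add: M vec.scale)
    then show "w \<in> range ((*v) ?Mb)" by blast
  next
    fix w assume "w \<in> range ((*v) ?Mb)"
    then obtain y where y: "w = ?Mb *v y" by blast
    obtain v where "A *v v = y" using surj by blast
    then have "w = ?Ma *v (c *s v)" using y M[of v] by (simp add: vec.scale)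
    then show "w \<in> range ((*v) ?Ma)" by blast
  qed
qed

text \<open>Equality of the ranges provides for each \<open>v\<close> a vector at which the forms \<open>b\<close> take the values of the
  forms \<open>a\<close> at \<open>v\<close>. By injectivity it is unique and depends linearly on \<open>v\<close>.\<close>

lemma range_eq_imp_iso:
  assumes nfa: "normalized_forms (Suc m) a p" and nfb: "normalized_forms (Suc m) b q"
    and ran: "range ((*v) (difference_matrix ix m a)) = range ((*v) (difference_matrix ix m b))"
  shows "(arrangement_of (Suc m) a p, arrangement_of (Suc m) b q) \<in> pointed_arrangement_iso (Suc m)"
proof -
  let ?Ma = "difference_matrix ix m a" and ?Mb = "difference_matrix ix m b"
  have ap: "scalar_product (a i) p = 1" and bq: "scalar_product (b i) q = 1" if "i < Suc m" for i
    using nfa nfb that by (simp_all add: normalized_forms_def)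
  have "\<exists>y. ?Mb *v y = ?Ma *v v \<and> scalar_product (b m) y = scalar_product (a m) v" for v
  proof -
    obtain u where u: "?Mb *v u = ?Ma *v v" using ran by (metis rangeE rangeI)
    \<comment> \<open>Adding a multiple of \<open>q\<close> leaves the differences alone and shifts all forms by the same amount.\<close>
    let ?y = "u + (scalar_product (a m) v - scalar_product (b m) u) *s q"
    have "?Mb *v ?y = ?Ma *v v"
      by (simp only: vec.add vec.scale u difference_matrix_point[OF nfb] vec.scale_zero_right add_0_right)
    moreover have "scalar_product (b m) ?y = scalar_product (a m) v"
      using bq by (simp add: scalar_product_simps)
    ultimately show ?thesis by blast
  qed
  then obtain g where g: "\<And>v. ?Mb *v g v = ?Ma *v v"
    "\<And>v. scalar_product (b m) (g v) = scalar_product (a m) v"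
    by metis
  have lin: "Vector_Spaces.linear (*s) (*s) g"
  proof
    show "g (x + y) = g x + g y" for x y
      by (rule normalized_forms_eqI[OF nfb]) (simp_all add: g vec.add scalar_product_simps)
    show "g (r *s x) = r *s g x" for r x
      by (rule normalized_forms_eqI[OF nfb]) (simp_all add: g vec.scale scalar_product_simps)
  qed
  define A where "A = matrix g"
  have A: "A *v v = g v" for v using matrix_works[OF lin] by (simp add: A_def)
  have form: "scalar_product (b i) (A *v v) = scalar_product (a i) v" if "i < Suc m" for i v
    using that
  proof (cases rule: ix_cases)
    case (2 n)
    have "(?Mb *v g v) $ n = (?Ma *v v) $ n" using g by simp
    then show ?thesis using g(2)[of v] 2 by (simp add: A difference_matrix_nth)
  qed (simp add: A g)
  have "v = 0" if "A *v v = 0" for v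
    using form[of _ v] nfa that by (simp add: normalized_forms_def scalar_product_simps)
  then have inv: "invertible A"
    by (simp add: invertible_left_inverse matrix_left_invertible_ker)
  have surj: "\<exists>v. A *v v = y" for y
    using inv by (metis invertible_right_inverse matrix_right_invertible_surjective surjD)
  have "A *v p = q"
  proof (rule normalized_forms_eqI[OF nfb])
    show "?Mb *v (A *v p) = ?Mb *v q"
      using difference_matrix_point[OF nfa] difference_matrix_point[OF nfb] by (simp add: A g)
    show "scalar_product (b m) (A *v p) = scalar_product (b m) q"
      using ap bq by (simp add: A g)
  qed
  then have point: "(*v) A ` proj_pt p = proj_pt q" by (simp add: proj_aut_proj_pt)
  have "(*v) A ` hyperplane (a i) = hyperplane (b i)" if i: "i < Suc m" for i
  proof (intro equalityI subsetI)
    fix y assume y: "y \<in> hyperplane (b i)"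
    obtain v where "A *v v = y" using surj by blast
    then show "y \<in> (*v) A ` hyperplane (a i)" using y form[OF i, of v] by auto
  qed (use form[OF i] in auto)
  then have lines: "(`) ((*v) A) ` proj_subspace (hyperplane (a i)) = proj_subspace (hyperplane (b i))"
    if "i < Suc m" for i
    using that inv by (simp add: proj_aut_proj_subspace)
  have "(`) ((*v) A) \<in> proj_auts" using inv by (auto simp: proj_auts_def)
  then show ?thesis
    using arrangement_of_mem[OF nfa] arrangement_of_mem[OF nfb] point lines
    unfolding pointed_arrangement_iso_def arrangement_of_def
    by (simp del: upt_Suc) (rule bexI[of _ "(`) ((*v) A)"], simp_all del: upt_Suc)
qed

text \<open>For a basis \<open>u\<close>, \<open>v\<close> of \<open>W\<close> the forms \<open>u\<^sub>n x + v\<^sub>n y + z\<close>, with \<open>z\<close> as the last form and the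
  base point \<open>[0 : 0 : 1]\<close>, have the differences \<open>u\<^sub>n x + v\<^sub>n y\<close>.\<close>

lemma plane_is_range:
  fixes W :: "('a::field^'n) set"
  assumes W: "vec.subspace W" "vec.dim W = 2" and gen: "\<not> in_one_hyperplane W"
  obtains a :: "nat \<Rightarrow> 'a^3" and p where "normalized_forms (Suc m) a p"
    "range ((*v) (difference_matrix ix m a)) = W"
proof -
  obtain u v where uv: "W = {s *s u + t *s v | s t. True}"
    and ind: "\<And>s t. s *s u + t *s v = 0 \<Longrightarrow> s = 0 \<and> t = 0"
    by (rule basis_of_dim_2[OF W], rule that) blast+
  define r where "r = inv_into UNIV ix"
  have r: "r (ix n) = n" for n
    using ix by (simp add: r_def bij_betw_def)
  define a :: "nat \<Rightarrow> 'a^3" where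
    "a k = (if k < m then vector [u $ r k, v $ r k, 1] else vector [0, 0, 1])" for k
  have sp: "scalar_product (vector [x, y, z]) w = x * w $ 1 + y * w $ 2 + z * w $ 3"
    for x y z :: 'a and w :: "'a^3"
    by (simp add: scalar_product_def sum_3)
  have aix: "scalar_product (a (ix n)) w = u $ n * w $ 1 + v $ n * w $ 2 + w $ 3"
    and am: "scalar_product (a m) w = w $ 3" for n w
    using ix_less by (simp_all add: a_def sp r)
  have Mw: "difference_matrix ix m a *v w = w $ 1 *s u + w $ 2 *s v" for w
    by (simp add: vec_eq_iff difference_matrix_nth aix am mult.commute)
  have ran: "range ((*v) (difference_matrix ix m a)) = W"
  proof (intro equalityI subsetI)
    fix x assume "x \<in> W"
    then obtain s t where "x = s *s u + t *s v" unfolding uv by blast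
    then have "x = difference_matrix ix m a *v vector [s, t, 0]" by (simp add: Mw)
    then show "x \<in> range ((*v) (difference_matrix ix m a))" by blast
  qed (auto simp: Mw uv)
  have "inj_on a {..<Suc m}"
  proof (rule inj_onI)
    fix k l assume k: "k \<in> {..<Suc m}" and l: "l \<in> {..<Suc m}" and eq: "a k = a l"
    have last: False if "a (ix n) = a m" for n
    proof -
      have "(difference_matrix ix m a *v w) $ n = 0" for w
        using that by (simp add: difference_matrix_nth)
      then show False using gen ran unfolding in_one_hyperplane_def by blast
    qed
    have other: "n = n'" if "a (ix n) = a (ix n')" for n n'
    proof (rule ccontr)
      assume "n \<noteq> n'"
      moreover have "(difference_matrix ix m a *v w) $ n = (difference_matrix ix m a *v w) $ n'" for w
        using that by (simp add: difference_matrix_nth)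
      ultimately show False using gen ran unfolding in_one_hyperplane_def by blast
    qed
    have kl: "k < Suc m" "l < Suc m" using k l by simp_all
    show "k = l"
    proof (rule ix_cases[OF kl(1)]; rule ix_cases[OF kl(2)])
      fix n assume "k = ix n" "l = m"
      then show ?thesis using last[of n] eq by simp
    next
      fix n assume "k = m" "l = ix n"
      then show ?thesis using last[of n] eq by simp
    next
      fix n n' assume "k = ix n" "l = ix n'"
      then show ?thesis using other[of n n'] eq by simp
    qed simp
  qed
  moreover have "w = 0" if w: "\<forall>i<Suc m. scalar_product (a i) w = 0" for w
  proof -
    have w3: "w $ 3 = 0" using w[rule_format, of m] am by simp
    have "difference_matrix ix m a *v w = 0"
      using w less_SucI[OF ix_less] by (simp add: vec_eq_iff difference_matrix_nth)
    then have "w $ 1 = 0 \<and> w $ 2 = 0" using ind[of "w $ 1" "w $ 2"] Mw[of w] by simp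
    with w3 show ?thesis by (simp add: vec_eq_iff forall_3)
  qed
  moreover have "scalar_product (a i) (vector [0, 0, 1]) = 1" if "i < Suc m" for i
    using that by (simp add: a_def sp)
  ultimately have "normalized_forms (Suc m) a (vector [0, 0, 1])"
    by (simp add: normalized_forms_def)
  with ran show ?thesis using that by blast
qed

end

section \<open>The correspondence\<close>

theorem proposition2p1:
  fixes d :: nat
  assumes "d \<ge> 3"
    and "CARD('n::finite) = d - 1"
  shows "\<exists>f. bij_betw f
           (pointed_arrangement_classes d
              :: (('a::field, 3) proj_point set list \<times> ('a, 3) proj_point) set set)
           {l \<in> (proj_lines :: ('a, 'n) proj_point set set). \<not> contained_in_hyp_arrangement l}"
proof -
  obtain m where d: "d = Suc m" and m: "CARD('n) = m"
    using assms by (intro that[of "d - 1"]) simp_all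
  obtain ix :: "'n \<Rightarrow> nat" where "bij_betw ix UNIV {..<m}"
    using ex_bij_betw_finite_nat[of "UNIV :: 'n set"] m by (auto simp: atLeast0LessThan)
  then interpret indexing ix m by unfold_locales
  let ?W = "\<lambda>a :: nat \<Rightarrow> 'a^3. range ((*v) (difference_matrix ix m a))"
  define R where "R = (\<lambda>x l. \<exists>a p. normalized_forms d a p \<and> x = arrangement_of d a p \<and>
    l = proj_subspace (?W a))"
  let ?Y = "{l \<in> (proj_lines :: ('a, 'n) proj_point set set). \<not> contained_in_hyp_arrangement l}"
  have plane: "vec.subspace (?W a)" "vec.dim (?W a) = 2" if "normalized_forms d a p" for a p
    using dim_range_difference_matrix subspace_range_matrix that d by blast+
  show ?thesis
    unfolding pointed_arrangement_classes_def
  proof (rule bij_betw_quotient_of_relation[where R = R])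
    fix x :: "('a, 3) proj_point set list \<times> ('a, 3) proj_point"
    assume "x \<in> pointed_arrangements d"
    then obtain a p where ap: "normalized_forms d a p" "x = arrangement_of d a p"
      by (rule pointed_arrangement_normalized)
    have "proj_subspace (?W a) \<in> proj_lines"
      using plane[OF ap(1)] unfolding proj_lines_def by blast
    moreover have "\<not> contained_in_hyp_arrangement (proj_subspace (?W a))"
      using plane[OF ap(1)] range_difference_matrix_not_in_one_hyperplane ap(1) d
      by (simp add: contained_in_hyp_arrangement_iff)
    moreover have "R x (proj_subspace (?W a))" unfolding R_def using ap by blast
    ultimately show "\<exists>l\<in>?Y. R x l" by blast
  next
    fix l assume "l \<in> ?Y"
    then obtain W where W: "l = proj_subspace W" "vec.subspace W" "vec.dim W = 2"
      "\<not> in_one_hyperplane W"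
      by (auto simp: proj_lines_def contained_in_hyp_arrangement_iff)
    obtain a :: "nat \<Rightarrow> 'a^3" and p where ap: "normalized_forms d a p" "?W a = W"
      unfolding d by (rule plane_is_range[OF W(2-4)])
    have "R (arrangement_of d a p) l"
      unfolding R_def using ap W(1) by blast
    moreover have "arrangement_of d a p \<in> pointed_arrangements d"
      using ap(1) d by (intro arrangement_of_mem) simp_all
    ultimately show "\<exists>x\<in>pointed_arrangements d. R x l" by blast
  next
    fix x x' l l' assume "R x l" "R x' l'"
    then obtain a p b q where a: "normalized_forms d a p" "x = arrangement_of d a p"
        "l = proj_subspace (?W a)"
      and b: "normalized_forms d b q" "x' = arrangement_of d b q" "l' = proj_subspace (?W b)"
      unfolding R_def by blast
    have "\<Union>l = ?W a" "\<Union>l' = ?W b"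
      using plane[OF a(1)] plane[OF b(1)] by (simp_all add: a(3) b(3) Union_proj_subspace)
    then have "(x, x') \<in> pointed_arrangement_iso d \<longleftrightarrow> ?W a = ?W b"
      using iso_imp_range_eq[of a p b q] range_eq_imp_iso[of a p b q] a(1,2) b(1,2)
      unfolding d by blast
    also have "\<dots> \<longleftrightarrow> l = l'"
      using \<open>\<Union>l = ?W a\<close> \<open>\<Union>l' = ?W b\<close> a(3) b(3) by metis
    finally show "(x, x') \<in> pointed_arrangement_iso d \<longleftrightarrow> l = l'" .
  next
    show "pointed_arrangement_iso d \<subseteq> pointed_arrangements d \<times> (pointed_arrangements d
      :: (('a, 3) proj_point set list \<times> ('a, 3) proj_point) set)"
      by (auto simp: pointed_arrangement_iso_def)
  qed
qed

end
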